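(* Let $w,v\in L\setminus K$ with $\mathrm{tr}_{K|\mathbb{F}_2}(1/\tau(w))=\mathrm{tr}_{K|\mathbb{F}_2}(1/\tau(v))=0$. Then $B_q(w)$ is isotopic to $B_q(v)$ if and only if $v=\phi(w)$ for some field automorphism $\phi$ of $L=\mathbb{F}_{q^2}$. The order of the autotopism group of $B_q(w)$ is $2\iota(q^2-1)^2$, where $\iota$ is the order of the stabilizer of $w$ in the Galois group of $L$ over $\mathbb{F}_2$.
   Context: Let $s\ge1$, $q=2^s$, $K=\mathbb{F}_q\subset L=\mathbb{F}_{q^2}$, $\tau:L\to K$, $\tau(u)=u+u^q$, the trace, and $\mathrm{tr}_{K|\mathbb{F}_2}$ the absolute trace of $K$. For $w\in L\setminus K$ with $\mathrm{tr}_{K|\mathbb{F}_2}(1/\tau(w))=0$, $B_q(w)$ is the semifield on $L\times L$ with multiplication $$(a,b)\star(c,d)=(ac+bd^q+wb^qd,\ a^qd+bc).$$ Two (pre)semifields $(F,+,* )$ and $(F,+,\circ)$ are isotopic if there are additive bijections $\alpha_1,\alpha_2,\beta$ of $F$ with $\beta(\alpha_1(x)*\alpha_2(y))=x\circ y$ for all $x,y$; such a triple $(\alpha_1,\alpha_2,\beta)$ is an isotopy, and an autotopism of $(F,+,* )$ is an isotopy from $(F,+,* )$ to itself. The autotopisms form the autotopism group. *)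

theory Defs
  imports Complex_Main "HOL-Algebra.Group_Action" "HOL-Library.Product_Plus" "HOL-Library.Cardinality"
begin

subsection \<open>Finite fields\<close>

definition is_subfield :: "'a::field set \<Rightarrow> bool" where
  "is_subfield K \<longleftrightarrow> 0 \<in> K \<and> 1 \<in> K \<and>
     (\<forall>x\<in>K. \<forall>y\<in>K. x - y \<in> K \<and> x * y \<in> K) \<and> (\<forall>x\<in>K. inverse x \<in> K)"

definition field_automorphism :: "('a::field \<Rightarrow> 'a) \<Rightarrow> bool" where
  "field_automorphism \<phi> \<longleftrightarrow>
     bij \<phi> \<and> (\<forall>x y. \<phi> (x + y) = \<phi> x + \<phi> y) \<and> (\<forall>x y. \<phi> (x * y) = \<phi> x * \<phi> y) \<and> \<phi> 1 = 1"

text \<open>Automorphisms of the whole type that fix the subfield \<open>F\<close> pointwise.\<close>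

definition galois_group :: "'a::field set \<Rightarrow> ('a \<Rightarrow> 'a) monoid" where
  "galois_group F =
     \<lparr>carrier = {\<phi>. field_automorphism \<phi> \<and> (\<forall>x\<in>F. \<phi> x = x)}, mult = (\<circ>), one = id\<rparr>"

lemma group_galois_group: "group (galois_group F)"
proof (rule groupI)
  fix f assume f: "f \<in> carrier (galois_group F)"
  then have b: "bij f" and c: "field_automorphism f" and x: "\<forall>x\<in>F. f x = x"
    by (auto simp: galois_group_def field_automorphism_def)
  have s: "f (inv_into UNIV f y) = y" and i: "inv_into UNIV f (f y) = y" for y
    using b by (simp_all add: bij_is_surj surj_f_inv_f bij_is_inj)
  have "field_automorphism (inv_into UNIV f)"
    unfolding field_automorphism_def
  proof (intro conjI allI)
    show "bij (inv_into UNIV f)" using b by (rule bij_imp_bij_inv)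
    show "inv_into UNIV f (x + y) = inv_into UNIV f x + inv_into UNIV f y" for x y
    proof -
      have "f (inv_into UNIV f x + inv_into UNIV f y) = x + y"
        using c by (simp add: field_automorphism_def s)
      then show ?thesis using i[of "inv_into UNIV f x + inv_into UNIV f y"] by simp
    qed
    show "inv_into UNIV f (x * y) = inv_into UNIV f x * inv_into UNIV f y" for x y
    proof -
      have "f (inv_into UNIV f x * inv_into UNIV f y) = x * y"
        using c by (simp add: field_automorphism_def s)
      then show ?thesis using i[of "inv_into UNIV f x * inv_into UNIV f y"] by simp
    qed
    show "inv_into UNIV f 1 = 1" using c i[of 1] by (simp add: field_automorphism_def)
  qed
  moreover have "\<forall>x\<in>F. inv_into UNIV f x = x"
  proof
    show "inv_into UNIV f x = x" if "x \<in> F" for x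
      using x i[of x] that by simp
  qed
  ultimately show "\<exists>g\<in>carrier (galois_group F). g \<otimes>\<^bsub>galois_group F\<^esub> f = \<one>\<^bsub>galois_group F\<^esub>"
    using b by (intro bexI[of _ "inv_into UNIV f"]) (auto simp: galois_group_def bij_is_inj)
qed (auto simp: galois_group_def field_automorphism_def bij_comp comp_assoc)

text \<open>For \<open>q = 2 ^ s\<close>: the relative trace from the field with \<open>q\<^sup>2\<close> elements to the field with
  \<open>q\<close> elements, and the absolute trace of the latter, the sum of the conjugates under the powers of
  the Frobenius map. The values of the absolute trace are regarded as elements of the big field.\<close>

definition rel_trace :: "nat \<Rightarrow> 'a::field \<Rightarrow> 'a" where
  "rel_trace q u = u + u ^ q"

definition abs_trace :: "nat \<Rightarrow> 'a::field \<Rightarrow> 'a" where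
  "abs_trace s x = (\<Sum>i<s. x ^ (2 ^ i))"

subsection \<open>Isotopisms\<close>

definition isotopy ::
  "('b::ab_group_add \<Rightarrow> 'b \<Rightarrow> 'b) \<Rightarrow> ('b \<Rightarrow> 'b \<Rightarrow> 'b) \<Rightarrow> ('b \<Rightarrow> 'b) \<times> ('b \<Rightarrow> 'b) \<times> ('b \<Rightarrow> 'b) \<Rightarrow> bool"
where
  "isotopy m m' = (\<lambda>(\<alpha>\<^sub>1, \<alpha>\<^sub>2, \<beta>).
     additive \<alpha>\<^sub>1 \<and> bij \<alpha>\<^sub>1 \<and> additive \<alpha>\<^sub>2 \<and> bij \<alpha>\<^sub>2 \<and> additive \<beta> \<and> bij \<beta> \<and>
     (\<forall>x y. \<beta> (m (\<alpha>\<^sub>1 x) (\<alpha>\<^sub>2 y)) = m' x y))"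

definition isotopic :: "('b::ab_group_add \<Rightarrow> 'b \<Rightarrow> 'b) \<Rightarrow> ('b \<Rightarrow> 'b \<Rightarrow> 'b) \<Rightarrow> bool" where
  "isotopic m m' \<longleftrightarrow> (\<exists>t. isotopy m m' t)"

text \<open>In the equation \<open>\<beta> (\<alpha>\<^sub>1 x * \<alpha>\<^sub>2 y) = x * y\<close> the map \<open>\<beta>\<close> acts contravariantly relative
  to \<open>\<alpha>\<^sub>1\<close> and \<open>\<alpha>\<^sub>2\<close>, so its components are composed in the opposite order.\<close>

definition autotopism_group ::
  "('b::ab_group_add \<Rightarrow> 'b \<Rightarrow> 'b) \<Rightarrow> (('b \<Rightarrow> 'b) \<times> ('b \<Rightarrow> 'b) \<times> ('b \<Rightarrow> 'b)) monoid"
where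
  "autotopism_group m =
     \<lparr>carrier = {t. isotopy m m t},
      mult = (\<lambda>(\<alpha>\<^sub>1, \<alpha>\<^sub>2, \<beta>) (\<gamma>\<^sub>1, \<gamma>\<^sub>2, \<delta>). (\<alpha>\<^sub>1 \<circ> \<gamma>\<^sub>1, \<alpha>\<^sub>2 \<circ> \<gamma>\<^sub>2, \<delta> \<circ> \<beta>)),
      one = (id, id, id)\<rparr>"

lemma additive_inv:
  fixes f :: "'b::ab_group_add \<Rightarrow> 'b"
  assumes "additive f" "bij f"
  shows "additive (inv_into UNIV f)"
proof
  fix x y
  have s: "f (inv_into UNIV f z) = z" and i: "inv_into UNIV f (f z) = z" for z
    using assms(2) by (simp_all add: bij_is_surj surj_f_inv_f bij_is_inj)
  show "inv_into UNIV f (x + y) = inv_into UNIV f x + inv_into UNIV f y"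
  proof -
    have "f (inv_into UNIV f x + inv_into UNIV f y) = x + y"
      using assms(1) by (simp add: additive.add s)
    then show ?thesis using i[of "inv_into UNIV f x + inv_into UNIV f y"] by simp
  qed
qed

lemma group_autotopism_group: "group (autotopism_group m)"
proof (rule groupI)
  fix t assume t: "t \<in> carrier (autotopism_group m)"
  obtain a b c where abc: "t = (a, b, c)" by (cases t)
  have h: "additive a" "bij a" "additive b" "bij b" "additive c" "bij c"
    and e: "\<And>x y. c (m (a x) (b y)) = m x y"
    using t by (auto simp: autotopism_group_def isotopy_def abc)
  have "inv_into UNIV c (m (inv_into UNIV a x) (inv_into UNIV b y)) = m x y" for x y
  proof -
    have "m (inv_into UNIV a x) (inv_into UNIV b y) = c (m x y)"
      using e[of "inv_into UNIV a x" "inv_into UNIV b y"] h by (simp add: bij_is_surj surj_f_inv_f)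
    then show ?thesis using h by (simp add: bij_is_inj)
  qed
  then have "(inv_into UNIV a, inv_into UNIV b, inv_into UNIV c) \<in> carrier (autotopism_group m)"
    using h by (auto simp: autotopism_group_def isotopy_def additive_inv bij_imp_bij_inv)
  moreover have "(inv_into UNIV a, inv_into UNIV b, inv_into UNIV c) \<otimes>\<^bsub>autotopism_group m\<^esub> t = \<one>\<^bsub>autotopism_group m\<^esub>"
    using h by (simp add: autotopism_group_def abc bij_is_inj surj_iff[THEN iffD1] bij_is_surj)
  ultimately show
    "\<exists>u\<in>carrier (autotopism_group m). u \<otimes>\<^bsub>autotopism_group m\<^esub> t = \<one>\<^bsub>autotopism_group m\<^esub>"
    by blast
qed (auto simp: autotopism_group_def isotopy_def additive_def bij_comp comp_assoc)

subsection \<open>The semifield multiplication\<close>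

definition B_mult :: "nat \<Rightarrow> 'a::field \<Rightarrow> 'a \<times> 'a \<Rightarrow> 'a \<times> 'a \<Rightarrow> 'a \<times> 'a" where
  "B_mult q w = (\<lambda>(a, b) (c, d). (a * c + b * d ^ q + w * b ^ q * d, a ^ q * d + b * c))"

end

theory Submission
  imports "HOL-Computational_Algebra.Polynomial" "HOL-Number_Theory.Residues" Defs
begin

text \<open>
  The middle nucleus of \<open>B\<^sub>q(w)\<close> is \<open>L \<times> {0}\<close>, so the maps \<open>\<alpha>\<^sub>1, \<alpha>\<^sub>2\<close> of an isotopy are semilinear over
  \<open>L\<close> with a common companion automorphism \<open>\<phi>\<close>, and the product factors through the tensor
  product, that is, through the \<open>2 \<times> 2\<close> matrices over \<open>L\<close>. In the coordinates \<open>(a, b)\<close> and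
  \<open>(c, e)\<close> with \<open>e = d\<^sup>q\<close> the kernel of the product is
  \<open>U\<^sub>w = {[[x + w x\<^sup>q, y], [y\<^sup>q, x]]}\<close>, and the isotopies with companion \<open>\<phi>\<close> are the pairs of
  invertible matrices \<open>A, B\<close> with \<open>A U\<^sub>v B = U\<^sub>w\<close>, where \<open>v\<close> stands for \<open>\<phi>(v)\<close>. Comparing the polar
  forms of the determinant \<open>x\<^sup>2 + w N(x) + N(y)\<close> on both spaces forces \<open>v = w\<close> and forces \<open>A, B\<close> to be
  both diagonal or both antidiagonal. In either case one nonzero entry of \<open>A\<close> and one of \<open>B\<close> can be
  chosen freely and determine the others, square roots being unique in characteristic \<open>2\<close>. The
  trace condition enters only as \<open>N(w) \<noteq> 1\<close>.
\<close>

section \<open>Field automorphisms\<close>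

lemma field_automorphism_inv:
  assumes "field_automorphism f"
  shows "field_automorphism (inv_into UNIV f)"
proof -
  have b: "bij f" using assms by (simp add: field_automorphism_def)
  have s: "f (inv_into UNIV f y) = y" and i: "inv_into UNIV f (f y) = y" for y
    using b by (simp_all add: bij_is_surj surj_f_inv_f bij_is_inj)
  show ?thesis
    unfolding field_automorphism_def
  proof (intro conjI allI)
    show "bij (inv_into UNIV f)" using b by (rule bij_imp_bij_inv)
    show "inv_into UNIV f (x + y) = inv_into UNIV f x + inv_into UNIV f y" for x y
      using i[of "inv_into UNIV f x + inv_into UNIV f y"] assms by (simp add: field_automorphism_def s)
    show "inv_into UNIV f (x * y) = inv_into UNIV f x * inv_into UNIV f y" for x y
      using i[of "inv_into UNIV f x * inv_into UNIV f y"] assms by (simp add: field_automorphism_def s)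
    show "inv_into UNIV f 1 = 1" using i[of 1] assms by (simp add: field_automorphism_def)
  qed
qed

lemma field_automorphism_simps:
  assumes "field_automorphism f"
  shows "f (x + y) = f x + f y" "f (x * y) = f x * f y" "f 0 = 0" "f 1 = 1" "f (x ^ n) = f x ^ n"
    "f x = f y \<longleftrightarrow> x = y" "f (inv_into UNIV f x) = x" "inv_into UNIV f (f x) = x"
proof -
  show add: "f (x + y) = f x + f y" and mult: "f (x * y) = f x * f y" and one: "f 1 = 1" for x y
    using assms by (auto simp: field_automorphism_def)
  show "f 0 = 0" using add[of 0 0] by (metis add_cancel_right_right add_0)
  show "f (x ^ n) = f x ^ n" by (induction n) (simp_all add: mult one)
  have "bij f" using assms by (simp add: field_automorphism_def)
  then show "f x = f y \<longleftrightarrow> x = y" "f (inv_into UNIV f x) = x" "inv_into UNIV f (f x) = x"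
    by (simp_all add: bij_is_surj surj_f_inv_f bij_is_inj inj_eq)
qed

section \<open>Characteristic 2 and conjugation of L over K\<close>

locale quadratic_extension =
  fixes s q :: nat and L :: "'a::{field,finite} itself"
  assumes s_pos: "s \<ge> 1" and q_eq: "q = 2 ^ s" and card_L: "CARD('a) = q ^ 2"
begin

lemma char_2: "(2::'a) = 0"
proof -
  have "prime CHAR('a)"
    using prime_CHAR_semidom finite_imp_CHAR_pos by (metis finite)
  moreover have "CHAR('a) dvd 2 ^ (s * 2)"
    using CHAR_dvd_CARD[where 'a='a] card_L q_eq by (simp add: power_mult)
  ultimately have "CHAR('a) = 2"
    by (metis prime_dvd_power primes_dvd_imp_eq two_is_prime_nat)
  then show ?thesis
    using of_nat_CHAR[where 'a='a] by simp
qed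

text \<open>These rules remove all signs and cancel repeated summands, so that identities in
  characteristic 2 reduce to commutative ring normalization.\<close>

lemma add_self [simp]: "x + x = (0::'a)"
  using char_2 by (metis mult_2 mult_zero_left)

lemma add_self' [simp]: "x + (x + y) = (y::'a)"
  by (simp add: add.assoc [symmetric])

lemma uminus_eq [simp]: "- x = (x::'a)"
  using add_self[of x] by (metis add_eq_0_iff)

lemma minus_eq [simp]: "x - y = (x + y::'a)"
  using add_self[of y] by (metis uminus_eq diff_conv_add_uminus)

lemma add_eq_0 [simp]: "x + y = (0::'a) \<longleftrightarrow> x = y"
  using minus_eq[of x y] by (metis eq_iff_diff_eq_0)

lemma power_2_add: "(x + y::'a) ^ (2 ^ n) = x ^ (2 ^ n) + y ^ (2 ^ n)"
proof (induction n)
  case (Suc n)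
  have "(x + y) ^ (2 ^ Suc n) = (x ^ (2 ^ n) + y ^ (2 ^ n)) ^ 2"
    by (simp only: power_Suc mult.commute[of 2] power_mult Suc)
  also have "\<dots> = (x ^ (2 ^ n)) ^ 2 + (y ^ (2 ^ n)) ^ 2"
    by (simp add: power2_sum char_2)
  finally show ?case by (simp add: power_mult[symmetric] mult.commute)
qed simp

text \<open>The nontrivial automorphism of L over K; being a power map, it is available without
  naming K.\<close>

definition cj :: "'a \<Rightarrow> 'a" where "cj x = x ^ q"

lemma cj_0 [simp]: "cj 0 = 0" and cj_1 [simp]: "cj 1 = 1"
  and cj_add: "cj (x + y) = cj x + cj y" and cj_mult: "cj (x * y) = cj x * cj y"
  and cj_divide: "cj (x / y) = cj x / cj y" and cj_power: "cj (x ^ n) = cj x ^ n"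
proof -
  have cj: "cj x = x ^ (2 ^ s)" for x unfolding cj_def by (simp only: q_eq)
  show "cj 0 = 0" "cj 1 = 1" "cj (x + y) = cj x + cj y" "cj (x * y) = cj x * cj y"
    "cj (x / y) = cj x / cj y" "cj (x ^ n) = cj x ^ n"
    by (simp_all add: cj power_2_add power_mult_distrib power_divide
        power_mult[symmetric] mult.commute)
qed

lemma power_CARD: "x ^ CARD('a) = (x::'a)"
proof (cases "x = 0")
  case False
  have "bij_betw ((*) x) (UNIV - {0}) (UNIV - {0})"
    by (rule bij_betwI[of _ _ _ "(*) (inverse x)"]) (use False in auto)
  then have "(\<Prod>y\<in>UNIV - {0}. x * y) = (\<Prod>y\<in>UNIV - {0}. y)"
    by (rule prod.reindex_bij_betw)
  then have "x ^ (CARD('a) - 1) = 1"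
    by (simp add: prod.distrib card_Diff_singleton)
  moreover have "CARD('a) = Suc (CARD('a) - 1)" by simp
  ultimately show ?thesis by (metis power_Suc mult.right_neutral)
qed simp

lemma cj_cj [simp]: "cj (cj x) = x"
  using power_CARD[of x] card_L by (simp add: cj_def power_mult[symmetric] power2_eq_square)

lemma cj_eq_0 [simp]: "cj x = 0 \<longleftrightarrow> x = 0"
  using cj_cj cj_0 by metis

lemma cj_inj [simp]: "cj x = cj y \<longleftrightarrow> x = y"
  using cj_cj by metis

lemmas cj_simps = cj_add cj_mult cj_divide cj_power

text \<open>Multiplication by a nonzero element permutes the nonzero elements of K, which makes
  every element of K a root of X^q + X. This polynomial has at most q roots, so K is its whole root
  set.\<close>

lemma subfield_iff_cj:
  assumes "is_subfield K" "card K = q"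
  shows "x \<in> K \<longleftrightarrow> cj x = x"
proof -
  have K: "cj y = y" if "y \<in> K" for y
  proof (cases "y = 0")
    case False
    have K0: "0 \<in> K" and inv: "inverse y \<in> K" and m: "\<And>a b. a \<in> K \<Longrightarrow> b \<in> K \<Longrightarrow> a * b \<in> K"
      using assms(1) that by (auto simp: is_subfield_def)
    have "bij_betw ((*) y) (K - {0}) (K - {0})"
      by (rule bij_betwI[of _ _ _ "(*) (inverse y)"]) (use False m that inv in auto)
    then have "(\<Prod>z\<in>K - {0}. y * z) = (\<Prod>z\<in>K - {0}. z)"
      by (rule prod.reindex_bij_betw)
    then have "y ^ (q - 1) = 1"
      using assms(2) K0 by (simp add: prod.distrib card_Diff_singleton)
    moreover have "q = Suc (q - 1)" using q_eq by simp
    ultimately show ?thesis unfolding cj_def by (metis power_Suc mult.right_neutral)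
  qed simp
  define f :: "'a poly" where "f = Polynomial.monom 1 q + Polynomial.monom 1 1"
  have q1: "q > 1" using q_eq s_pos by (metis one_less_numeral_iff one_less_power semiring_norm(76) less_le_trans zero_less_one)
  have deg: "Polynomial.degree f = q"
    unfolding f_def using q1 by (subst degree_add_eq_left) (auto simp: degree_monom_eq)
  then have "f \<noteq> 0" using q1 by auto
  then have "card {x. poly f x = 0} \<le> q"
    using card_poly_roots_bound[of f] deg by simp
  moreover have "{x. poly f x = 0} = {x. cj x = x}"
    by (simp add: f_def poly_monom cj_def)
  ultimately have "card {x. cj x = x} \<le> card K" using assms(2) by simp
  then have "K = {x. cj x = x}"
    using K by (intro card_seteq) auto
  then show ?thesis by blast
qed

text \<open>An element of norm \<open>1\<close> outside the subfield would make \<open>z = w / \<tau>(w)\<close> a solution of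
  \<open>z\<^sup>2 + z = 1 / \<tau>(w)\<^sup>2\<close> with \<open>z\<^sup>q + z = 1\<close>.\<close>

lemma norm_neq_1:
  assumes "cj w \<noteq> w" "abs_trace s (1 / rel_trace q w) = 0"
  shows "w * cj w \<noteq> 1"
proof
  assume N: "w * cj w = 1"
  define t where "t = w + cj w"
  define z where "z = w / t"
  have t: "t \<noteq> 0" using assms(1) by (auto simp: t_def)
  have tq: "cj t = t" by (simp add: t_def cj_add)
  have "w ^ 2 + w * t = 1" using N by (simp add: t_def algebra_simps power2_eq_square)
  then have z: "z ^ 2 + z = (1 / t) ^ 2"
    using t by (simp add: z_def field_simps power2_eq_square)
  \<comment> \<open>Under the absolute trace \<open>z ^ 2 + z\<close> telescopes to
    \<open>z ^ q + z\<close>, while the trace of a square is the square of the trace; the trace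
    condition therefore forces \<open>cj z = z\<close>.\<close>
  have tel: "(\<Sum>i<n. (z ^ 2 + z) ^ (2 ^ i)) = z ^ (2 ^ n) + z" for n
  proof (induction n)
    case (Suc n)
    have "(z ^ 2 + z) ^ (2 ^ n) = z ^ (2 ^ Suc n) + z ^ (2 ^ n)"
      by (simp add: power_2_add power_mult[symmetric])
    then show ?case using Suc by (simp add: algebra_simps)
  qed simp
  have sq: "(\<Sum>i<n. ((1 / t) ^ 2) ^ (2 ^ i)) = (\<Sum>i<n. (1 / t) ^ (2 ^ i)) ^ 2" for n
    by (induction n) (simp_all add: power2_sum char_2 power_mult[symmetric] mult.commute)
  have "z ^ (2 ^ s) + z = (abs_trace s (1 / t)) ^ 2"
    using tel[of s] sq[of s] z by (simp add: abs_trace_def)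
  moreover have "abs_trace s (1 / t) = 0"
    using assms(2) by (simp add: rel_trace_def t_def cj_def)
  ultimately have "cj z = z" unfolding cj_def by (simp add: q_eq)
  then have "cj w = w" using t tq by (simp add: z_def cj_divide)
  then show False using assms(1) by simp
qed

section \<open>The middle nucleus and the companion automorphism\<close>

lemma B_mult_cj:
  "B_mult q w (a, b) (c, d) = (a * c + b * cj d + w * cj b * d, cj a * d + b * c)"
  by (simp add: B_mult_def cj_def)

lemma B_mult_one: "B_mult q (w::'a) (1, 0) y = y" "B_mult q w x (1, 0) = x"
proof -
  show "B_mult q w (1, 0) y = y" by (cases y) (simp add: B_mult_cj)
  show "B_mult q w x (1, 0) = x" by (cases x) (simp add: B_mult_cj)
qed

text \<open>Inserting the identity \<open>(1, 0)\<close> on either side shows that \<open>P\<close>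
  is right and \<open>Q\<close> is left multiplication by one element \<open>(n, k)\<close>; testing
  at \<open>(w, 0)\<close> and \<open>(0, 1)\<close> with \<open>w\<close> outside K kills
  \<open>k\<close>.\<close>

lemma middle_nucleus:
  assumes w: "cj w \<noteq> w"
    and PQ: "\<And>x y. B_mult q v (P x) y = B_mult q v x (Q y)"
  obtains n where "\<And>a b. P (a, b) = (a * n, b * n)" "\<And>c d. Q (c, d) = (n * c, cj n * d)"
proof -
  obtain n k where nk: "Q (1, 0) = (n, k)" by fastforce
  have P: "P x = B_mult q v x (n, k)" for x
    using PQ[of x "(1, 0)"] nk by (simp add: B_mult_one)
  have Q: "Q y = B_mult q v (n, k) y" for y
    using PQ[of "(1, 0)" y] P[of "(1, 0)"] by (simp add: B_mult_one)
  have "cj w * k = w * k"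
    using PQ[of "(w, 0)" "(0, 1)"] by (simp add: P Q B_mult_cj cj_simps algebra_simps)
  then have "k = 0" using w by simp
  then show ?thesis using P Q by (intro that[of n]) (auto simp: B_mult_cj)
qed

text \<open>Conjugating the multiplications by nucleus elements with \<open>\<alpha>\<^sub>1\<close>
  and \<open>\<alpha>\<^sub>2\<close> gives maps of the same kind, by \<open>middle_nucleus\<close>.
  The induced change of scalars \<open>\<sigma>\<close> is a field automorphism, and its inverse is
  the companion.\<close>

lemma isotopy_semilinear:
  assumes v: "cj v \<noteq> v" and iso: "isotopy (B_mult q w) (B_mult q v) (\<alpha>\<^sub>1, \<alpha>\<^sub>2, \<beta>)"
  obtains \<phi> where "field_automorphism \<phi>"
    "\<And>a b m. \<alpha>\<^sub>1 (a * m, b * m) = (fst (\<alpha>\<^sub>1 (a, b)) * \<phi> m, snd (\<alpha>\<^sub>1 (a, b)) * \<phi> m)"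
    "\<And>c d m. \<alpha>\<^sub>2 (m * c, cj m * d) = (\<phi> m * fst (\<alpha>\<^sub>2 (c, d)), cj (\<phi> m) * snd (\<alpha>\<^sub>2 (c, d)))"
proof -
  have h: "additive \<alpha>\<^sub>1" "bij \<alpha>\<^sub>1" "bij \<alpha>\<^sub>2" "bij \<beta>"
    and e: "\<And>x y. \<beta> (B_mult q w (\<alpha>\<^sub>1 x) (\<alpha>\<^sub>2 y)) = B_mult q v x y"
    using iso by (auto simp: isotopy_def)
  note i1 = surj_f_inv_f[OF bij_is_surj[OF h(2)]] and i2 = surj_f_inv_f[OF bij_is_surj[OF h(3)]]
  \<comment> \<open>\<open>M m\<close> and \<open>M' m\<close> are right and left multiplication by
    \<open>(m, 0)\<close>; \<open>MM'\<close> says that \<open>(m, 0)\<close> lies in the middle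
    nucleus.\<close>
  define M where "M = (\<lambda>m (a, b). (a * m, b * m :: 'a))"
  define M' where "M' = (\<lambda>m (c, d). (m * c, cj m * d))"
  have MM': "B_mult q w (M m x) y = B_mult q w x (M' m y)" for m x y
    by (cases x; cases y) (simp add: M_def M'_def B_mult_cj cj_simps algebra_simps)
  have ex: "\<exists>n. (\<forall>a b. inv_into UNIV \<alpha>\<^sub>1 (M m (\<alpha>\<^sub>1 (a, b))) = (a * n, b * n)) \<and>
      (\<forall>c d. inv_into UNIV \<alpha>\<^sub>2 (M' m (\<alpha>\<^sub>2 (c, d))) = (n * c, cj n * d))" for m
  proof -
    have "B_mult q v (inv_into UNIV \<alpha>\<^sub>1 (M m (\<alpha>\<^sub>1 x))) y = B_mult q v x (inv_into UNIV \<alpha>\<^sub>2 (M' m (\<alpha>\<^sub>2 y)))" for x y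
      by (simp add: e[symmetric] i1 i2 MM')
    from middle_nucleus[OF v this] show ?thesis by metis
  qed
  then obtain \<sigma> where "\<And>m a b. inv_into UNIV \<alpha>\<^sub>1 (M m (\<alpha>\<^sub>1 (a, b))) = (a * \<sigma> m, b * \<sigma> m)"
    and "\<And>m c d. inv_into UNIV \<alpha>\<^sub>2 (M' m (\<alpha>\<^sub>2 (c, d))) = (\<sigma> m * c, cj (\<sigma> m) * d)"
    by metis
  then have s1: "\<alpha>\<^sub>1 (a * \<sigma> m, b * \<sigma> m) = M m (\<alpha>\<^sub>1 (a, b))"
    and s2: "\<alpha>\<^sub>2 (\<sigma> m * c, cj (\<sigma> m) * d) = M' m (\<alpha>\<^sub>2 (c, d))" for m a b c d
    using i1 i2 by metis+
  \<comment> \<open>The image of \<open>(1, 0)\<close> is nonzero, so injectivity of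
    \<open>\<alpha>\<^sub>1\<close> turns each law for \<open>M\<close> into a law for
    \<open>\<sigma>\<close>.\<close>
  have s0: "\<alpha>\<^sub>1 (\<sigma> m, 0) = M m (\<alpha>\<^sub>1 (1, 0))" for m
    using s1[of 1 m 0] by simp
  have inj: "\<alpha>\<^sub>1 x = \<alpha>\<^sub>1 y \<longleftrightarrow> x = y" for x y using h(2) by (simp add: bij_is_inj inj_eq)
  have "\<alpha>\<^sub>1 (1, 0) \<noteq> 0"
    using inj[of "(1, 0)" 0] additive.zero[OF h(1)] by (simp add: zero_prod_def)
  then have "inj \<sigma>"
    using s0 by (intro injI) (auto simp: M_def case_prod_beta zero_prod_def prod_eq_iff dest!: arg_cong[of "\<sigma> _" "\<sigma> _" "\<lambda>m. \<alpha>\<^sub>1 (m, 0)"])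
  then have "bij \<sigma>" by (simp add: bij_def finite_UNIV_inj_surj)
  moreover have "\<sigma> (m + n) = \<sigma> m + \<sigma> n" for m n
  proof -
    have "\<alpha>\<^sub>1 (\<sigma> (m + n), 0) = \<alpha>\<^sub>1 ((\<sigma> m, 0) + (\<sigma> n, 0))"
      unfolding additive.add[OF h(1)] s0
      by (cases "\<alpha>\<^sub>1 (1, 0)") (simp add: M_def algebra_simps)
    then show ?thesis using inj by simp
  qed
  moreover have "\<sigma> (m * n) = \<sigma> m * \<sigma> n" for m n
  proof -
    have "\<alpha>\<^sub>1 (\<sigma> (m * n), 0) = \<alpha>\<^sub>1 (\<sigma> m * \<sigma> n, 0)"
      using s1[of "\<sigma> m" n 0] s0
      by (cases "\<alpha>\<^sub>1 (1, 0)") (simp add: M_def algebra_simps)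
    then show ?thesis using inj by simp
  qed
  moreover have "\<sigma> 1 = 1"
  proof -
    have "\<alpha>\<^sub>1 (\<sigma> 1, 0) = \<alpha>\<^sub>1 (1, 0)"
      using s0 by (cases "\<alpha>\<^sub>1 (1, 0)") (simp add: M_def)
    then show ?thesis using inj by simp
  qed
  ultimately have \<sigma>: "field_automorphism \<sigma>" by (simp add: field_automorphism_def)
  show ?thesis
  proof (rule that[OF field_automorphism_inv[OF \<sigma>]])
    show "\<alpha>\<^sub>1 (a * m, b * m) = (fst (\<alpha>\<^sub>1 (a, b)) * inv_into UNIV \<sigma> m, snd (\<alpha>\<^sub>1 (a, b)) * inv_into UNIV \<sigma> m)" for a b m
      using s1[of a "inv_into UNIV \<sigma> m" b] field_automorphism_simps(7)[OF \<sigma>]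
      by (simp add: M_def case_prod_beta)
    show "\<alpha>\<^sub>2 (m * c, cj m * d) = (inv_into UNIV \<sigma> m * fst (\<alpha>\<^sub>2 (c, d)), cj (inv_into UNIV \<sigma> m) * snd (\<alpha>\<^sub>2 (c, d)))" for c d m
      using s2[of "inv_into UNIV \<sigma> m" c d] field_automorphism_simps(7)[OF \<sigma>]
      by (simp add: M'_def case_prod_beta)
  qed
qed

section \<open>Linear isotopies as pairs of matrices\<close>

text \<open>With \<open>A = (a\<^sub>i, b\<^sub>i)\<close> and \<open>B = (c\<^sub>i, e\<^sub>i)\<close>, the equations \<open>E1\<close>--\<open>E8\<close> compare the coefficients
  of \<open>X, X\<^sup>q, Y, Y\<^sup>q\<close> in the condition that \<open>(A, B)\<close> maps \<open>U\<^sub>v\<close> into \<open>U\<^sub>w\<close>.\<close>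

lemma linear_isotopy_scalars:
  assumes w: "cj w \<noteq> w" and v: "cj v \<noteq> v" and Nv: "v * cj v \<noteq> 1"
    and A: "a1 * b2 + a2 * b1 \<noteq> 0" and B: "c1 * e2 + c2 * e1 \<noteq> 0"
    and E1: "b1 * c1 + b2 * c2 = cj v * cj (a1 * e1)"
    and E2: "v * (b1 * c1) = cj (a1 * e1 + a2 * e2)"
    and E3: "b1 * c2 = cj (a2 * e1)"
    and E4: "b2 * c1 = cj (a1 * e2)"
    and E5: "a1 * c1 + a2 * c2 = b1 * e1 + b2 * e2 + w * (cj v * cj (b1 * e1))"
    and E6: "v * (a1 * c1) = v * (b1 * e1) + w * cj (b1 * e1 + b2 * e2)"
    and E7: "a1 * c2 = b1 * e2 + w * cj (b2 * e1)"
    and E8: "a2 * c1 = b2 * e1 + w * cj (b1 * e2)"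
  shows "v = w"
    "a2 = 0 \<and> b1 = 0 \<and> c2 = 0 \<and> e1 = 0 \<and> a1 * c1 = b2 * e2 \<and> (b2 * e2)\<^sup>2 = a1 * e2 * cj (a1 * e2) \<or>
     a1 = 0 \<and> b2 = 0 \<and> c1 = 0 \<and> e2 = 0 \<and> a2 * c2 = b1 * e1 * (1 + w * cj w) \<and>
       (b1 * e1)\<^sup>2 * (1 + w * cj w) = a2 * e1 * cj (a2 * e1)"
proof -
  define D where "D = (a1 * b2 + a2 * b1) * (c1 * e2 + c2 * e1)"
  define p p' r r' t t' u u'
    where "p = b1 * e1 + b2 * e2" and "p' = v * (b1 * e1)" and "r = b1 * e2" and "r' = b2 * e1"
      and "t = a1 * e1 + a2 * e2" and "t' = v * (a1 * e1)" and "u = a1 * e2" and "u' = a2 * e1"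
  note defs = p_def p'_def r_def r'_def t_def t'_def u_def u'_def
  have D: "D \<noteq> 0" using A B by (simp add: D_def)
  have v0: "v \<noteq> 0" using v by auto
  have F: "b1 * c1 + b2 * c2 = cj t'" "v * (b1 * c1) = cj t" "b1 * c2 = cj u'" "b2 * c1 = cj u"
    "a1 * c1 + a2 * c2 = p + w * cj p'" "v * (a1 * c1) = p' + w * cj p" "a1 * c2 = r + w * cj r'"
    "a2 * c1 = r' + w * cj r"
    using E1 E2 E3 E4 E5 E6 E7 E8 by (simp_all add: defs cj_mult)
  text \<open>The image matrix has lower right entry \<open>p X + p' X\<^sup>q + r Y + r' Y\<^sup>q\<close> and upper right entry
    \<open>t X + t' X\<^sup>q + u Y + u' Y\<^sup>q\<close>; the next six equations are the coefficients of the polar form of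
    its determinant, which is \<open>D\<close> times the polar form of the original one.\<close>
  have XY: "w * (p * cj r' + r * cj p') = t * cj u' + u * cj t'"
  proof -
    have "w * (p * cj r' + r * cj p') + (t * cj u' + u * cj t') = (p + w * cj p') * r + (r + w * cj r') * p + t * cj u' + u * cj t'"
      by (simp add: algebra_simps)
    also have "\<dots> = 0"
      unfolding F[symmetric] unfolding p_def r_def t_def u_def by (simp add: algebra_simps)
    finally show ?thesis by simp
  qed
  have XY': "w * (cj p * r' + cj r * p') = cj t * u' + cj u * t'"
  proof -
    have "w * (cj p * r' + cj r * p') + (cj t * u' + cj u * t') = (p' + w * cj p) * r' + (r' + w * cj r) * p' + t' * cj u + u' * cj t"
      by (simp add: algebra_simps)
    also have "\<dots> = 0"
      unfolding F[symmetric] unfolding p'_def r'_def t'_def u'_def by (simp add: algebra_simps)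
    finally show ?thesis by simp
  qed
  have YX: "w * (p * cj r + r' * cj p') = t * cj u + u' * cj t'"
  proof -
    have "w * (p * cj r + r' * cj p') + (t * cj u + u' * cj t') = (p + w * cj p') * r' + (r' + w * cj r) * p + t * cj u + u' * cj t'"
      by (simp add: algebra_simps)
    also have "\<dots> = 0"
      unfolding F[symmetric] unfolding p_def r'_def t_def u'_def by (simp add: algebra_simps)
    finally show ?thesis by simp
  qed
  have YX': "w * (cj p * r + cj r' * p') = cj t * u + cj u' * t'"
  proof -
    have "w * (cj p * r + cj r' * p') + (cj t * u + cj u' * t') = (p' + w * cj p) * r + (r + w * cj r') * p' + t' * cj u' + u * cj t"
      by (simp add: algebra_simps)
    also have "\<dots> = 0"
      unfolding F[symmetric] unfolding p'_def r_def t'_def u_def by (simp add: algebra_simps)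
    finally show ?thesis by simp
  qed
  have XX: "w * (p * cj p + p' * cj p') + (t * cj t + t' * cj t') = D * v"
  proof -
    have "w * (p * cj p + p' * cj p') + (t * cj t + t' * cj t') = (p + w * cj p') * p' + (p' + w * cj p) * p + t * cj t + t' * cj t'"
      by (simp add: algebra_simps)
    also have "\<dots> = D * v"
      unfolding F[symmetric] unfolding p_def p'_def t_def t'_def D_def by (simp add: algebra_simps)
    finally show ?thesis .
  qed
  have YY: "w * (r * cj r + r' * cj r') + (u * cj u + u' * cj u') = D"
  proof -
    have "w * (r * cj r + r' * cj r') + (u * cj u + u' * cj u') = (r + w * cj r') * r' + (r' + w * cj r) * r + u * cj u + u' * cj u'"
      by (simp add: algebra_simps)
    also have "\<dots> = D"
      unfolding F[symmetric] unfolding r_def r'_def u_def u'_def D_def by (simp add: algebra_simps)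
    finally show ?thesis .
  qed
  \<comment> \<open>Conjugating the first equation gives \<open>cj w * cj Z = w * cj Z\<close>. As
    \<open>w\<close> is outside K, each mixed polar equation splits into two.\<close>
  have cancel: "Z = 0 \<and> S = 0" if "w * Z = S" "w * cj Z = cj S" for Z S
  proof -
    have "cj w * cj Z = w * cj Z" using that by (metis cj_mult)
    then show ?thesis using w that by (metis mult_cancel_right cj_eq_0 mult_zero_right)
  qed
  have 1: "p * cj r' = r * cj p'" "t * cj u' = u * cj t'"
    using cancel[OF XY] XY' by (simp_all add: cj_add cj_mult algebra_simps)
  have 2: "p * cj r = r' * cj p'" "t * cj u = u' * cj t'"
    using cancel[OF YX] YX' by (simp_all add: cj_add cj_mult algebra_simps)
  have key: "x * cj x * z = x' * cj x' * z" if "x * z = k * cj x'" "cj x * k = z * x'" for x x' z k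
  proof -
    have "x * cj x * z = cj x * (x * z)" by (simp only: mult_ac)
    also have "\<dots> = (cj x * k) * cj x'" unfolding that(1) by (simp only: mult_ac)
    also have "\<dots> = x' * cj x' * z" unfolding that(2) by (simp only: mult_ac)
    finally show ?thesis .
  qed
  \<comment> \<open>The hypotheses say that the K-linear maps X \<mapsto> x X + x' X^q and Y
    \<mapsto> y Y + y' Y^q have images orthogonal for the polar form of the norm. Their determinants
    are \<open>x * cj x + x' * cj x'\<close> and \<open>y * cj y + y' * cj y'\<close>; if one map is
    invertible, the other vanishes.\<close>
  have excl: "x * cj x = x' * cj x' \<or> y = 0 \<and> y' = 0"
    "y * cj y = y' * cj y' \<or> x = 0 \<and> x' = 0"
    if *: "x * cj y' = y * cj x'" "x * cj y = y' * cj x'" for x x' y y'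
  proof -
    have **: "cj x * y' = cj y * x'" "cj x * y = cj y' * x'"
      using arg_cong[OF *(1), of cj] arg_cong[OF *(2), of cj] by (simp_all add: cj_mult)
    have "x * cj x * cj y' = x' * cj x' * cj y'" by (rule key[OF *(1) **(2)])
    moreover have "x * cj x * cj y = x' * cj x' * cj y" by (rule key[OF *(2) **(1)])
    moreover have "y * cj y * cj x' = y' * cj y' * cj x'"
      by (rule key[of _ _ x]) (use * ** in \<open>simp_all add: mult.commute\<close>)
    moreover have "y * cj y * cj x = y' * cj y' * cj x"
      by (rule key[of _ _ x']) (use * ** in \<open>simp_all add: mult.commute\<close>)
    ultimately show "x * cj x = x' * cj x' \<or> y = 0 \<and> y' = 0" "y * cj y = y' * cj y' \<or> x = 0 \<and> x' = 0"
      by auto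
  qed
  note ex = excl[OF 1(1) 2(1)] excl[OF 1(2) 2(2)]
  \<comment> \<open>By \<open>XX\<close> and \<open>YY\<close>, if the map of \<open>(p, p')\<close>
    is invertible, then so is that of \<open>(u, u')\<close>, and these two kill the others.
    Otherwise the maps of \<open>(t, t')\<close> and \<open>(r, r')\<close> are invertible, against
    \<open>E7\<close> or \<open>E8\<close>.\<close>
  have good: "r = 0 \<and> r' = 0 \<and> t = 0 \<and> t' = 0"
  proof (cases "p * cj p = p' * cj p'")
    case False
    then have "r = 0 \<and> r' = 0" using ex by blast
    moreover from this have "u * cj u \<noteq> u' * cj u'" using YY D by auto
    then have "t = 0 \<and> t' = 0" using ex by blast
    ultimately show ?thesis by blast
  next
    case True
    then have "t * cj t \<noteq> t' * cj t'" using XX D v0 by auto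
    then have u0: "u = 0" "u' = 0" using ex by blast+
    then have nr: "r * cj r \<noteq> r' * cj r'" using YY D by auto
    then have p0: "p = 0" "p' = 0" using ex by blast+
    have e: "a1 * e2 = 0" "a2 * e1 = 0" "b1 * e1 = 0" "b2 * e2 = 0"
      using u0 p0 v0 by (auto simp: defs)
    consider "b1 * e2 \<noteq> 0" | "b2 * e1 \<noteq> 0" using nr by (force simp: defs)
    then have False
    proof cases
      case 1
      then show False using e E7 A by auto
    next
      case 2
      then show False using e E8 A by auto
    qed
    then show ?thesis ..
  qed
  then have z: "b1 * e2 = 0" "b2 * e1 = 0" "a1 * e1 = 0" "a2 * e2 = 0"
    using v0 by (auto simp: defs)
  have fixed_sqrt: "cj x = x" if "cj (x\<^sup>2) = x\<^sup>2" for x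
  proof -
    have "(cj x + x)\<^sup>2 = 0" using that by (simp add: power2_sum char_2 cj_power)
    then show ?thesis by simp
  qed
  \<comment> \<open>If \<open>e1 = 0\<close>, then \<open>e2\<close> is nonzero and clears
    \<open>b1\<close> and \<open>a2\<close>, after which \<open>E1\<close> clears \<open>c2\<close>:
    the diagonal shape. A nonzero \<open>e1\<close> leads to the antidiagonal one.\<close>
  consider "e1 = 0" "a2 = 0" "b1 = 0" "c2 = 0" "b2 \<noteq> 0" "e2 \<noteq> 0"
    | "e2 = 0" "a1 = 0" "b2 = 0" "c1 = 0" "b1 \<noteq> 0" "e1 \<noteq> 0"
    using z E1 A B by (cases "e1 = 0") auto
  then have "v = w \<and> (a2 = 0 \<and> b1 = 0 \<and> c2 = 0 \<and> e1 = 0 \<and> a1 * c1 = b2 * e2 \<and> (b2 * e2)\<^sup>2 = a1 * e2 * cj (a1 * e2) \<or>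
     a1 = 0 \<and> b2 = 0 \<and> c1 = 0 \<and> e2 = 0 \<and> a2 * c2 = b1 * e1 * (1 + w * cj w) \<and>
       (b1 * e1)\<^sup>2 * (1 + w * cj w) = a2 * e1 * cj (a2 * e1))"
  proof cases
    case 1
    have ac: "a1 * c1 = b2 * e2" using E5 1 by simp
    have sq: "(b2 * e2)\<^sup>2 = a1 * e2 * cj (a1 * e2)"
    proof -
      have "(b2 * e2)\<^sup>2 = (a1 * c1) * (b2 * e2)" by (simp add: ac power2_eq_square)
      also have "\<dots> = a1 * e2 * (b2 * c1)" by (simp only: mult_ac)
      finally show ?thesis unfolding E4 .
    qed
    \<comment> \<open>The square of \<open>b2 * e2\<close> is a norm, and square roots of elements
      of K lie in K; then \<open>E6\<close> reads
      \<open>v * (b2 * e2) = w * (b2 * e2)\<close>.\<close>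
    have "cj (b2 * e2) = b2 * e2"
      by (rule fixed_sqrt, unfold sq) (simp add: cj_mult algebra_simps)
    then have "v = w" using E6 ac 1 by simp
    then show ?thesis using 1 ac sq by simp
  next
    case 2
    have vp: "v * (b1 * e1) = w * cj (b1 * e1)" using E6 2 by simp
    have ac: "a2 * c2 = b1 * e1 * (1 + v * cj v)"
    proof -
      have "a2 * c2 = b1 * e1 + cj v * (w * cj (b1 * e1))" using E5 2 by (simp add: mult.left_commute)
      then show ?thesis unfolding vp[symmetric] by (simp add: algebra_simps)
    qed
    have sq: "(b1 * e1)\<^sup>2 * (1 + v * cj v) = a2 * e1 * cj (a2 * e1)"
    proof -
      have "(b1 * e1)\<^sup>2 * (1 + v * cj v) = (a2 * c2) * (b1 * e1)" unfolding ac power2_eq_square by (simp only: mult_ac)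
      also have "\<dots> = a2 * e1 * (b1 * c2)" by (simp only: mult_ac)
      finally show ?thesis unfolding E3 .
    qed
    \<comment> \<open>The factor \<open>1 + v * cj v\<close> is a nonzero element of K because the
      norm of \<open>v\<close> is not 1, so it cancels from \<open>sq\<close>.\<close>
    have "cj (b1 * e1) = b1 * e1"
    proof (rule fixed_sqrt)
      have "cj ((b1 * e1)\<^sup>2 * (1 + v * cj v)) = (b1 * e1)\<^sup>2 * (1 + v * cj v)"
        unfolding sq by (simp add: cj_mult algebra_simps)
      moreover have "cj (1 + v * cj v) = 1 + v * cj v" "1 + v * cj v \<noteq> 0"
        using Nv by (simp_all add: cj_simps mult.commute)
      ultimately show "cj ((b1 * e1)\<^sup>2) = (b1 * e1)\<^sup>2"
        by (metis cj_mult mult_cancel_right)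
    qed
    then have "v = w" using vp 2 by simp
    then show ?thesis using 2 ac sq by simp
  qed
  then show "v = w"
    "a2 = 0 \<and> b1 = 0 \<and> c2 = 0 \<and> e1 = 0 \<and> a1 * c1 = b2 * e2 \<and> (b2 * e2)\<^sup>2 = a1 * e2 * cj (a1 * e2) \<or>
     a1 = 0 \<and> b2 = 0 \<and> c1 = 0 \<and> e2 = 0 \<and> a2 * c2 = b1 * e1 * (1 + w * cj w) \<and>
       (b1 * e1)\<^sup>2 * (1 + w * cj w) = a2 * e1 * cj (a2 * e1)"
    by blast+
qed

section \<open>Normal form of an isotopy\<close>

lemma cj_independent:
  assumes w: "cj w \<noteq> w" and "\<And>X Y. p * X + p' * cj X + r * Y + r' * cj Y = 0"
  shows "p = 0 \<and> p' = 0 \<and> r = 0 \<and> r' = 0"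
proof -
  have "p = p'" "p * w = p' * cj w" "r = r'" "r * w = r' * cj w"
    using assms(2)[of 1 0] assms(2)[of w 0] assms(2)[of 0 1] assms(2)[of 0 w] by simp_all
  then show ?thesis using w by (metis mult_cancel_left)
qed

lemma field_automorphism_cj: "field_automorphism \<phi> \<Longrightarrow> \<phi> (cj x) = cj (\<phi> x)"
  by (simp add: cj_def field_automorphism_simps)

text \<open>Reduces the semilinear case to \<open>linear_isotopy_scalars\<close>: the companion
  replaces \<open>v\<close> by \<open>\<phi> v\<close>, and the images of \<open>(1, 0)\<close> and
  \<open>(0, 1)\<close> supply the columns of the matrices.\<close>

lemma isotopy_form:
  assumes w: "cj w \<noteq> w" and v: "cj v \<noteq> v" and Nv: "v * cj v \<noteq> 1"
    and iso: "isotopy (B_mult q w) (B_mult q v) (\<alpha>\<^sub>1, \<alpha>\<^sub>2, \<beta>)"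
  obtains \<phi> a1 a2 b1 b2 c1 c2 e1 e2
  where "field_automorphism \<phi>" "\<phi> v = w"
    "\<alpha>\<^sub>1 = (\<lambda>(x, y). (a1 * \<phi> x + a2 * \<phi> y, b1 * \<phi> x + b2 * \<phi> y))"
    "\<alpha>\<^sub>2 = (\<lambda>(x, y). (c1 * \<phi> x + c2 * \<phi> (cj y), cj (e1 * \<phi> x + e2 * \<phi> (cj y))))"
    "a1 * b2 + a2 * b1 \<noteq> 0"
    "c1 * e2 + c2 * e1 \<noteq> 0"
    "a2 = 0 \<and> b1 = 0 \<and> c2 = 0 \<and> e1 = 0 \<and> a1 * c1 = b2 * e2 \<and> (b2 * e2)\<^sup>2 = a1 * e2 * cj (a1 * e2) \<or>
     a1 = 0 \<and> b2 = 0 \<and> c1 = 0 \<and> e2 = 0 \<and> a2 * c2 = b1 * e1 * (1 + w * cj w) \<and>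
       (b1 * e1)\<^sup>2 * (1 + w * cj w) = a2 * e1 * cj (a2 * e1)"
proof -
  from isotopy_semilinear[OF v iso] obtain \<phi> where \<phi>: "field_automorphism \<phi>"
    and l1: "\<And>a b m. \<alpha>\<^sub>1 (a * m, b * m) = (fst (\<alpha>\<^sub>1 (a, b)) * \<phi> m, snd (\<alpha>\<^sub>1 (a, b)) * \<phi> m)"
    and l2: "\<And>c d m. \<alpha>\<^sub>2 (m * c, cj m * d) = (\<phi> m * fst (\<alpha>\<^sub>2 (c, d)), cj (\<phi> m) * snd (\<alpha>\<^sub>2 (c, d)))"
    by blast
  note \<phi>s = field_automorphism_simps[OF \<phi>] field_automorphism_cj[OF \<phi>]
  have h: "additive \<alpha>\<^sub>1" "bij \<alpha>\<^sub>1" "additive \<alpha>\<^sub>2" "bij \<alpha>\<^sub>2" "bij \<beta>"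
    and e: "\<And>x y. \<beta> (B_mult q w (\<alpha>\<^sub>1 x) (\<alpha>\<^sub>2 y)) = B_mult q v x y"
    using iso by (auto simp: isotopy_def)
  obtain a1 b1 a2 b2 c1 c2 e1' e2' where
    ab: "\<alpha>\<^sub>1 (1, 0) = (a1, b1)" "\<alpha>\<^sub>1 (0, 1) = (a2, b2)" and
    ce': "\<alpha>\<^sub>2 (1, 0) = (c1, e1')" "\<alpha>\<^sub>2 (0, 1) = (c2, e2')"
    by fastforce
  \<comment> \<open>With its second coordinate conjugated, \<open>\<alpha>\<^sub>2\<close> becomes
    semilinear in \<open>(x, cj y)\<close>.\<close>
  define e1 e2 where "e1 = cj e1'" and "e2 = cj e2'"
  then have ce: "\<alpha>\<^sub>2 (1, 0) = (c1, cj e1)" "\<alpha>\<^sub>2 (0, 1) = (c2, cj e2)"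
    using ce' by simp_all
  have f1: "\<alpha>\<^sub>1 (x, y) = (a1 * \<phi> x + a2 * \<phi> y, b1 * \<phi> x + b2 * \<phi> y)" for x y
    using l1[of 1 x 0] l1[of 0 y 1] additive.add[OF h(1), of "(x, 0)" "(0, y)"] by (simp add: ab)
  have f2: "\<alpha>\<^sub>2 (x, y) = (c1 * \<phi> x + c2 * \<phi> (cj y), cj (e1 * \<phi> x + e2 * \<phi> (cj y)))" for x y
    using l2[of x 1 0] l2[of "cj y" 0 1] additive.add[OF h(3), of "(x, 0)" "(0, y)"]
    by (simp add: ce cj_simps mult.commute)
  have inj1: "\<alpha>\<^sub>1 x = \<alpha>\<^sub>1 y \<longleftrightarrow> x = y" and inj2: "\<alpha>\<^sub>2 x = \<alpha>\<^sub>2 y \<longleftrightarrow> x = y" for x y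
    using h by (simp_all add: bij_is_inj inj_eq)
  define \<psi> where "\<psi> = inv_into UNIV \<phi>"
  have \<psi>: "\<phi> (\<psi> x) = x" for x by (simp add: \<psi>_def \<phi>s)
  have A: "a1 * b2 + a2 * b1 \<noteq> 0"
  proof
    assume "a1 * b2 + a2 * b1 = 0"
    then have eq: "a1 * b2 = a2 * b1" by simp
    \<comment> \<open>For a singular matrix these vectors lie in the kernel of
      \<open>\<alpha>\<^sub>1\<close>, so all four entries vanish.\<close>
    have z: "\<alpha>\<^sub>1 (\<psi> a2, \<psi> a1) = \<alpha>\<^sub>1 (0, 0)" "\<alpha>\<^sub>1 (\<psi> b2, \<psi> b1) = \<alpha>\<^sub>1 (0, 0)"
      using eq by (simp_all add: f1 \<psi> \<phi>s mult.commute)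
    then have "\<psi> a2 = 0" "\<psi> a1 = 0" "\<psi> b2 = 0" "\<psi> b1 = 0"
      unfolding inj1 by simp_all
    then have "a1 = 0" "b1 = 0" using \<psi> \<phi>s(3) by metis+
    then have "\<alpha>\<^sub>1 (1, 0) = \<alpha>\<^sub>1 (0, 0)" using ab by (simp add: f1 \<phi>s)
    then show False unfolding inj1 by simp
  qed
  have B: "c1 * e2 + c2 * e1 \<noteq> 0"
  proof
    assume "c1 * e2 + c2 * e1 = 0"
    then have eq: "c1 * e2 = c2 * e1" by simp
    have z: "\<alpha>\<^sub>2 (\<psi> c2, cj (\<psi> c1)) = \<alpha>\<^sub>2 (0, 0)" "\<alpha>\<^sub>2 (\<psi> e2, cj (\<psi> e1)) = \<alpha>\<^sub>2 (0, 0)"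
      using eq by (simp_all add: f2 \<psi> \<phi>s mult.commute)
    then have "\<psi> c2 = 0" "\<psi> c1 = 0" "\<psi> e2 = 0" "\<psi> e1 = 0"
      unfolding inj2 by simp_all
    then have "c1 = 0" "e1 = 0" using \<psi> \<phi>s(3) by metis+
    then have "\<alpha>\<^sub>2 (1, 0) = \<alpha>\<^sub>2 (0, 0)" using ce by (simp add: f2 \<phi>s)
    then show False unfolding inj2 by simp
  qed
  define v' where "v' = \<phi> v"
  text \<open>The relation \<open>(1, 0) \<star> (x + v x\<^sup>q, y\<^sup>q) = (0, 1) \<star> (y\<^sup>q, x\<^sup>q)\<close> in \<open>B\<^sub>q(v)\<close> parametrizes \<open>U\<^sub>v\<close>.\<close>
  have eqs: "B_mult q w (a1, b1) (c1 * (X + v' * cj X) + c2 * Y, cj (e1 * (X + v' * cj X) + e2 * Y)) =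
      B_mult q w (a2, b2) (c1 * cj Y + c2 * X, cj (e1 * cj Y + e2 * X))" for X Y
  proof -
    define x y where "x = \<psi> X" and "y = \<psi> Y"
    have "B_mult q v (1, 0) (x + v * cj x, cj y) = B_mult q v (0, 1) (cj y, cj x)"
      by (simp add: B_mult_cj)
    then have "\<beta> (B_mult q w (\<alpha>\<^sub>1 (1, 0)) (\<alpha>\<^sub>2 (x + v * cj x, cj y))) =
        \<beta> (B_mult q w (\<alpha>\<^sub>1 (0, 1)) (\<alpha>\<^sub>2 (cj y, cj x)))"
      by (simp add: e)
    then have "B_mult q w (\<alpha>\<^sub>1 (1, 0)) (\<alpha>\<^sub>2 (x + v * cj x, cj y)) =
        B_mult q w (\<alpha>\<^sub>1 (0, 1)) (\<alpha>\<^sub>2 (cj y, cj x))"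
      using h(5) by (simp add: bij_is_inj inj_eq)
    then show ?thesis
      unfolding ab by (simp add: f2 \<phi>s x_def y_def \<psi> v'_def)
  qed
  note ind = cj_independent[OF w]
  \<comment> \<open>The left side is the sum of the first coordinates of both sides of
    \<open>eqs\<close>, hence 0. The second coordinates are treated in the same way, and
    \<open>cj_independent\<close> makes all coefficients vanish.\<close>
  have 1: "(a1 * c1 + a2 * c2 + (b1 * e1 + b2 * e2 + w * (cj v' * cj (b1 * e1)))) * X +
     (v' * (a1 * c1) + (v' * (b1 * e1) + w * cj (b1 * e1 + b2 * e2))) * cj X +
     (a1 * c2 + (b1 * e2 + w * cj (b2 * e1))) * Y +
     (a2 * c1 + (b2 * e1 + w * cj (b1 * e2))) * cj Y = 0" (is "?L = 0") for X Y
  proof -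
    have "?L = fst (B_mult q w (a1, b1) (c1 * (X + v' * cj X) + c2 * Y, cj (e1 * (X + v' * cj X) + e2 * Y))) +
      fst (B_mult q w (a2, b2) (c1 * cj Y + c2 * X, cj (e1 * cj Y + e2 * X)))"
      by (simp add: B_mult_cj cj_simps algebra_simps)
    then show ?thesis unfolding eqs by simp
  qed
  have 2: "(b1 * c1 + b2 * c2 + cj v' * cj (a1 * e1)) * X +
     (v' * (b1 * c1) + cj (a1 * e1 + a2 * e2)) * cj X +
     (b1 * c2 + cj (a2 * e1)) * Y + (b2 * c1 + cj (a1 * e2)) * cj Y = 0" (is "?L = 0") for X Y
  proof -
    have "?L = snd (B_mult q w (a1, b1) (c1 * (X + v' * cj X) + c2 * Y, cj (e1 * (X + v' * cj X) + e2 * Y))) +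
      snd (B_mult q w (a2, b2) (c1 * cj Y + c2 * X, cj (e1 * cj Y + e2 * X)))"
      by (simp add: B_mult_cj cj_simps algebra_simps)
    then show ?thesis unfolding eqs by simp
  qed
  have v': "cj v' \<noteq> v'" "v' * cj v' \<noteq> 1"
    using v Nv unfolding v'_def \<phi>s(9)[symmetric] \<phi>s(2)[symmetric] by (metis \<phi>s(6) \<phi>s(4))+
  have E: "b1 * c1 + b2 * c2 = cj v' * cj (a1 * e1)"
    "v' * (b1 * c1) = cj (a1 * e1 + a2 * e2)"
    "b1 * c2 = cj (a2 * e1)"
    "b2 * c1 = cj (a1 * e2)"
    "a1 * c1 + a2 * c2 = b1 * e1 + b2 * e2 + w * (cj v' * cj (b1 * e1))"
    "v' * (a1 * c1) = v' * (b1 * e1) + w * cj (b1 * e1 + b2 * e2)"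
    "a1 * c2 = b1 * e2 + w * cj (b2 * e1)"
    "a2 * c1 = b2 * e1 + w * cj (b1 * e2)"
    using ind[OF 1] ind[OF 2] unfolding add_eq_0 by blast+
  note cl = linear_isotopy_scalars[OF w v' A B E]
  show ?thesis
    by (rule that[OF \<phi> _ _ _ A B cl(2)]) (use cl(1) f1 f2 in \<open>auto simp: v'_def\<close>)
qed

section \<open>Unique square roots and the explicit autotopisms\<close>

definition sqrt2 :: "'a \<Rightarrow> 'a" where "sqrt2 x = inv_into UNIV (\<lambda>y. y\<^sup>2) x"

lemma square_inj: "x\<^sup>2 = y\<^sup>2 \<longleftrightarrow> x = (y::'a)"
proof
  assume "x\<^sup>2 = y\<^sup>2"
  then have "(x + y)\<^sup>2 = 0" by (simp add: power2_sum char_2)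
  then show "x = y" by simp
qed simp

lemma sqrt2_square [simp]: "(sqrt2 x)\<^sup>2 = x"
proof -
  have "surj (\<lambda>y::'a. y\<^sup>2)"
    by (rule finite_UNIV_inj_surj) (simp_all add: inj_def square_inj)
  then show ?thesis unfolding sqrt2_def by (rule surj_f_inv_f)
qed

lemma sqrt2_eqI: "y\<^sup>2 = x \<Longrightarrow> sqrt2 x = y"
  by (metis square_inj sqrt2_square)

lemma cj_sqrt2: "cj x = x \<Longrightarrow> cj (sqrt2 x) = sqrt2 x"
  by (metis cj_power square_inj sqrt2_square)

text \<open>The third component is written as the inverse of the map \<open>\<gamma>\<close> with
  \<open>\<gamma>(x \<star> y) = \<alpha>\<^sub>1 x \<star> \<alpha>\<^sub>2 y\<close>.\<close>

fun autotopism :: "'a \<Rightarrow> ('a \<Rightarrow> 'a) \<times> bool \<times> 'a \<times> 'a \<Rightarrow>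
    ('a \<times> 'a \<Rightarrow> 'a \<times> 'a) \<times> ('a \<times> 'a \<Rightarrow> 'a \<times> 'a) \<times> ('a \<times> 'a \<Rightarrow> 'a \<times> 'a)" where
  "autotopism w (\<phi>, False, a, e) = (let p = sqrt2 (a * e * cj (a * e)) in
     (\<lambda>(x, y). (a * \<phi> x, p / e * \<phi> y),
      \<lambda>(x, y). (p / a * \<phi> x, cj e * \<phi> y),
      inv_into UNIV (\<lambda>(x, y). (p * \<phi> x, cj (a * e) * \<phi> y))))"
| "autotopism w (\<phi>, True, a, e) = (let p = sqrt2 (a * e * cj (a * e) / (1 + w * cj w)) in
     (\<lambda>(x, y). (a * \<phi> y, p / e * \<phi> x),
      \<lambda>(x, y). (p * (1 + w * cj w) / a * \<phi> (cj y), cj e * \<phi> (cj x)),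
      inv_into UNIV (\<lambda>(x, y). (p * \<phi> (x + w * cj x), cj (a * e) * \<phi> (cj y)))))"

text \<open>On a finite space a trivial kernel makes an additive map bijective. Using the inverse of
  \<open>h\<close> as third component keeps inverses out of the identity to be verified.\<close>

lemma isotopyI_inv:
  fixes m m' :: "'a \<times> 'a \<Rightarrow> 'a \<times> 'a \<Rightarrow> 'a \<times> 'a"
  assumes "\<And>x y. f (x + y) = f x + f y" "\<And>x. f x = 0 \<Longrightarrow> x = 0"
    and "\<And>x y. g (x + y) = g x + g y" "\<And>x. g x = 0 \<Longrightarrow> x = 0"
    and "\<And>x y. h (x + y) = h x + h y" "\<And>x. h x = 0 \<Longrightarrow> x = 0"
    and "\<And>x y. m (f x) (g y) = h (m' x y)"
  shows "isotopy m m' (f, g, inv_into UNIV h)"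
proof -
  have bij: "bij k" if k: "\<And>x y. k (x + y) = k x + k y" "\<And>x. k x = 0 \<Longrightarrow> x = 0"
    for k :: "'a \<times> 'a \<Rightarrow> 'a \<times> 'a"
  proof -
    have "inj k"
    proof (rule injI)
      fix x y assume "k x = k y"
      then have "k (x - y) = 0" using k(1)[of "x - y" y] by simp
      then show "x = y" using k(2) by fastforce
    qed
    then show ?thesis by (simp add: bij_def finite_UNIV_inj_surj)
  qed
  have "inv_into UNIV h (h z) = z" for z using bij[OF assms(5,6)] by (simp add: bij_is_inj)
  then show ?thesis
    using bij[OF assms(1,2)] bij[OF assms(3,4)] bij[OF assms(5,6)] assms(1,3,5,7)
      additive_inv[of h] by (simp add: isotopy_def additive_def bij_imp_bij_inv del: split_paired_All)
qed

lemma isotopy_autotopism: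
  assumes w: "cj w \<noteq> w" "w * cj w \<noteq> 1" and \<phi>: "field_automorphism \<phi>" "\<phi> w = w"
    and ae: "a \<noteq> 0" "e \<noteq> 0"
  shows "isotopy (B_mult q w) (B_mult q w) (autotopism w (\<phi>, \<epsilon>, a, e))"
proof -
  note \<phi>s = field_automorphism_simps[OF \<phi>(1)] field_automorphism_cj[OF \<phi>(1)]
  have \<phi>0: "\<phi> x = 0 \<longleftrightarrow> x = 0" for x using \<phi>s(3,6) by metis
  have N: "1 + w * cj w \<noteq> 0" "cj (1 + w * cj w) = 1 + w * cj w"
    using w by (simp_all add: cj_simps mult.commute)
  \<comment> \<open>Substituting the conjugate equation gives \<open>x = w * cj w * x\<close>. This
    yields injectivity of \<open>x + w * cj x\<close> in the antidiagonal third map.\<close>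
  have kern: "x = w * cj x \<longleftrightarrow> x = 0" for x
  proof
    assume x: "x = w * cj x"
    then have "cj x = cj w * x" by (metis cj_cj cj_mult)
    with x have "x = w * cj w * x" by (simp add: mult.assoc)
    then show "x = 0" using w(2) by (metis mult_cancel_right1)
  qed simp
  show ?thesis
  proof (cases \<epsilon>)
    case False
    \<comment> \<open>The first coordinate of a product scales by \<open>p\<close> if
      \<open>a * c = b * e = p\<close>, the second by \<open>cj (a * e)\<close> if
      \<open>b * c = cj (a * e)\<close>; multiplying these gives the square of
      \<open>p\<close>.\<close>
    define p where "p = sqrt2 (a * e * cj (a * e))"
    define b c where "b = p / e" and "c = p / a"
    have p: "p * p = a * e * cj (a * e)" by (simp add: p_def flip: power2_eq_square)
    then have p0: "p \<noteq> 0" using ae by auto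
    have cp: "cj p = p" unfolding p_def by (rule cj_sqrt2) (simp add: cj_mult mult_ac)
    have 1: "a * c = p" "b * e = p" "b * c = cj (a * e)" and bc0: "b \<noteq> 0" "c \<noteq> 0"
      using ae p p0 by (auto simp: b_def c_def)
    have 2: "cj b * cj e = p" using 1 cp by (metis cj_mult)
    have "isotopy (B_mult q w) (B_mult q w)
      (\<lambda>(x, y). (a * \<phi> x, b * \<phi> y), \<lambda>(x, y). (c * \<phi> x, cj e * \<phi> y),
       inv_into UNIV (\<lambda>(x, y). (p * \<phi> x, cj (a * e) * \<phi> y)))"
    proof (rule isotopyI_inv)
      fix X Z :: "'a \<times> 'a"
      obtain x y z t where XZ: "X = (x, y)" "Z = (z, t)" by (cases X; cases Z)
      have t: "a * \<phi> x * (c * \<phi> z) = p * (\<phi> x * \<phi> z)"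
        "b * \<phi> y * (e * cj (\<phi> t)) = p * (\<phi> y * cj (\<phi> t))"
        "w * (cj b * cj (\<phi> y)) * (cj e * \<phi> t) = p * (w * cj (\<phi> y) * \<phi> t)"
        "b * \<phi> y * (c * \<phi> z) = cj (a * e) * (\<phi> y * \<phi> z)"
      proof -
        show "a * \<phi> x * (c * \<phi> z) = p * (\<phi> x * \<phi> z)"
          unfolding 1(1)[symmetric] by (simp only: mult_ac)
        show "b * \<phi> y * (e * cj (\<phi> t)) = p * (\<phi> y * cj (\<phi> t))"
          unfolding 1(2)[symmetric] by (simp only: mult_ac)
        show "w * (cj b * cj (\<phi> y)) * (cj e * \<phi> t) = p * (w * cj (\<phi> y) * \<phi> t)"
          unfolding 2[symmetric] by (simp only: mult_ac)
        show "b * \<phi> y * (c * \<phi> z) = cj (a * e) * (\<phi> y * \<phi> z)"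
          unfolding 1(3)[symmetric] by (simp only: mult_ac)
      qed
      have "a * \<phi> x * (c * \<phi> z) + b * \<phi> y * (e * cj (\<phi> t)) + w * (cj b * cj (\<phi> y)) * (cj e * \<phi> t) =
          p * (\<phi> x * \<phi> z + \<phi> y * cj (\<phi> t) + w * cj (\<phi> y) * \<phi> t)"
        by (simp only: t distrib_left)
      moreover have "cj a * cj (\<phi> x) * (cj e * \<phi> t) + b * \<phi> y * (c * \<phi> z) =
          cj (a * e) * (cj (\<phi> x) * \<phi> t + \<phi> y * \<phi> z)"
        unfolding t by (simp add: cj_mult algebra_simps)
      ultimately show "B_mult q w (case X of (x, y) \<Rightarrow> (a * \<phi> x, b * \<phi> y))
          (case Z of (x, y) \<Rightarrow> (c * \<phi> x, cj e * \<phi> y)) =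
        (case B_mult q w X Z of (x, y) \<Rightarrow> (p * \<phi> x, cj (a * e) * \<phi> y))"
        by (simp add: XZ B_mult_cj \<phi>s \<phi>(2) cj_mult)
    qed (use ae bc0 p0 in \<open>auto simp: \<phi>s \<phi>0 algebra_simps zero_prod_def\<close>)
    then show ?thesis using False by (simp add: Let_def p_def b_def c_def)
  next
    case True
    \<comment> \<open>In \<open>P + w * cj P\<close>, with \<open>P\<close> the first coordinate of
      the product, the term \<open>y * cj t\<close> occurs with coefficients 1 and
      \<open>w * cj w\<close>. Hence \<open>a * c\<close> must be \<open>p * (1 + w * cj w)\<close>,
      which explains the denominator.\<close>
    define p where "p = sqrt2 (a * e * cj (a * e) / (1 + w * cj w))"
    define b c where "b = p / e" and "c = p * (1 + w * cj w) / a"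
    have p: "p * p = a * e * cj (a * e) / (1 + w * cj w)" by (simp add: p_def flip: power2_eq_square)
    then have p0: "p \<noteq> 0" using ae N by auto
    have cp: "cj p = p" unfolding p_def
      by (rule cj_sqrt2) (simp only: cj_mult cj_divide N mult_ac cj_cj)
    have 1: "a * c = p * (1 + w * cj w)" "b * e = p" and bc0: "b \<noteq> 0" "c \<noteq> 0"
      using ae p0 N by (simp_all add: b_def c_def)
    have "b * c = p * p * (1 + w * cj w) / (a * e)" by (simp add: b_def c_def mult_ac)
    then have 3: "b * c = cj (a * e)" unfolding p using ae N(1) by simp
    have 2: "cj b * cj e = p" using 1 cp by (metis cj_mult)
    have "isotopy (B_mult q w) (B_mult q w)
      (\<lambda>(x, y). (a * \<phi> y, b * \<phi> x), \<lambda>(x, y). (c * \<phi> (cj y), cj e * \<phi> (cj x)),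
       inv_into UNIV (\<lambda>(x, y). (p * \<phi> (x + w * cj x), cj (a * e) * \<phi> (cj y))))"
    proof (rule isotopyI_inv)
      fix X Z :: "'a \<times> 'a"
      obtain x y z t where XZ: "X = (x, y)" "Z = (z, t)" by (cases X; cases Z)
      have t: "a * \<phi> y * (c * cj (\<phi> t)) = p * (1 + w * cj w) * (\<phi> y * cj (\<phi> t))"
        "b * \<phi> x * (e * \<phi> z) = p * (\<phi> x * \<phi> z)"
        "w * (cj b * cj (\<phi> x)) * (cj e * cj (\<phi> z)) = p * (w * cj (\<phi> x) * cj (\<phi> z))"
        "b * \<phi> x * (c * cj (\<phi> t)) = cj (a * e) * (\<phi> x * cj (\<phi> t))"
      proof -
        show "a * \<phi> y * (c * cj (\<phi> t)) = p * (1 + w * cj w) * (\<phi> y * cj (\<phi> t))"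
          unfolding 1(1)[symmetric] by (simp only: mult_ac)
        show "b * \<phi> x * (e * \<phi> z) = p * (\<phi> x * \<phi> z)"
          unfolding 1(2)[symmetric] by (simp only: mult_ac)
        show "w * (cj b * cj (\<phi> x)) * (cj e * cj (\<phi> z)) = p * (w * cj (\<phi> x) * cj (\<phi> z))"
          unfolding 2[symmetric] by (simp only: mult_ac)
        show "b * \<phi> x * (c * cj (\<phi> t)) = cj (a * e) * (\<phi> x * cj (\<phi> t))"
          unfolding 3[symmetric] by (simp only: mult_ac)
      qed
      define P where "P = \<phi> x * \<phi> z + \<phi> y * cj (\<phi> t) + w * cj (\<phi> y) * \<phi> t"
      have "a * \<phi> y * (c * cj (\<phi> t)) + b * \<phi> x * (e * \<phi> z) +
          w * (cj b * cj (\<phi> x)) * (cj e * cj (\<phi> z)) = p * (P + w * cj P)"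
        unfolding t P_def by (simp add: cj_simps algebra_simps)
      moreover have "cj a * cj (\<phi> y) * (cj e * cj (\<phi> z)) + b * \<phi> x * (c * cj (\<phi> t)) =
          cj (a * e) * cj (cj (\<phi> x) * \<phi> t + \<phi> y * \<phi> z)"
        unfolding t by (simp add: cj_simps algebra_simps)
      ultimately show "B_mult q w (case X of (x, y) \<Rightarrow> (a * \<phi> y, b * \<phi> x))
          (case Z of (x, y) \<Rightarrow> (c * \<phi> (cj y), cj e * \<phi> (cj x))) =
        (case B_mult q w X Z of (x, y) \<Rightarrow> (p * \<phi> (x + w * cj x), cj (a * e) * \<phi> (cj y)))"
        by (simp add: XZ B_mult_cj \<phi>s \<phi>(2) cj_simps P_def)
    qed (auto simp: \<phi>0 kern ae bc0 p0 zero_prod_def, auto simp: \<phi>s cj_add algebra_simps)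
    then show ?thesis using True by (simp add: Let_def p_def b_def c_def)
  qed
qed

text \<open>Choosing \<open>x\<close> with \<open>f x = (1, 0)\<close> exhibits every element as a
  product of values of \<open>f\<close> and \<open>g\<close>, so these two maps determine the
  third.\<close>

lemma isotopy_unique:
  fixes w w' :: 'a
  assumes "isotopy (B_mult q w) m (f, g, h)" "isotopy (B_mult q w) m (f, g, h')"
  shows "h = h'"
proof
  fix z
  have "surj f" "surj g" using assms(1) by (simp_all add: isotopy_def bij_is_surj)
  then obtain x y where "f x = (1, 0)" "g y = z" by (metis surjD)
  then have "B_mult q w (f x) (g y) = z" by (simp add: B_mult_one)
  then show "h z = h' z" using assms by (auto simp: isotopy_def simp del: split_paired_All)
qed

text \<open>The parameters are the companion, the shape and two free nonzero entries; counting them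
  gives the order of the group.\<close>

lemma autotopisms_bij:
  assumes w: "cj w \<noteq> w" "w * cj w \<noteq> 1"
  shows "bij_betw (autotopism w)
    ({\<phi>. field_automorphism \<phi> \<and> \<phi> w = w} \<times> UNIV \<times> (UNIV - {0}) \<times> (UNIV - {0}))
    {t. isotopy (B_mult q w) (B_mult q w) t}"
    (is "bij_betw _ ?P ?C")
proof (rule bij_betw_imageI)
  show "inj_on (autotopism w) ?P"
  proof (rule inj_onI)
    fix t t' assume t: "t \<in> ?P" "t' \<in> ?P" and eq: "autotopism w t = autotopism w t'"
    obtain \<phi> \<epsilon> a e \<phi>' \<epsilon>' a' e' where tt: "t = (\<phi>, \<epsilon>, a, e)" "t' = (\<phi>', \<epsilon>', a', e')"
      by (metis prod_cases4)
    with t have F: "field_automorphism \<phi>" "field_automorphism \<phi>'"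
      and nz: "a \<noteq> 0" "e \<noteq> 0" "a' \<noteq> 0" "e' \<noteq> 0" by auto
    note \<phi>s = field_automorphism_simps[OF F(1)] and \<phi>s' = field_automorphism_simps[OF F(2)]
    have f: "fst (autotopism w t) x = fst (autotopism w t') x"
      and g: "fst (snd (autotopism w t)) x = fst (snd (autotopism w t')) x" for x
      by (simp_all add: eq)
    \<comment> \<open>The first coordinate of the image of \<open>(1, 0)\<close> is nonzero exactly
      for the diagonal shape.\<close>
    have \<epsilon>: "\<epsilon> = \<epsilon>'"
      using f[of "(1, 0)"] nz by (cases \<epsilon>; cases \<epsilon>') (auto simp: tt Let_def \<phi>s \<phi>s')
    have a: "a = a'"
      using f[of "(1, 0)"] f[of "(0, 1)"] \<epsilon> by (cases \<epsilon>) (auto simp: tt Let_def \<phi>s \<phi>s')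
    have e: "e = e'"
      using g[of "(1, 0)"] g[of "(0, 1)"] \<epsilon> by (cases \<epsilon>) (auto simp: tt Let_def \<phi>s \<phi>s')
    have "\<phi> x = \<phi>' x" for x
      using f[of "(x, 0)"] f[of "(0, x)"] \<epsilon> a nz by (cases \<epsilon>) (auto simp: tt Let_def \<phi>s \<phi>s')
    then show "t = t'" using \<epsilon> a e tt by auto
  qed
  show "autotopism w ` ?P = ?C"
  proof (intro equalityI subsetI)
    fix t assume "t \<in> autotopism w ` ?P"
    then show "t \<in> ?C" using isotopy_autotopism[OF w] by auto
  next
    fix t assume t: "t \<in> ?C"
    obtain \<alpha>\<^sub>1 \<alpha>\<^sub>2 \<beta> where tt: "t = (\<alpha>\<^sub>1, \<alpha>\<^sub>2, \<beta>)" by (cases t)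
    with t have iso: "isotopy (B_mult q w) (B_mult q w) (\<alpha>\<^sub>1, \<alpha>\<^sub>2, \<beta>)" by simp
    from isotopy_form[OF w(1) w iso] obtain \<phi> a1 a2 b1 b2 c1 c2 e1 e2
      where \<phi>: "field_automorphism \<phi>" "\<phi> w = w"
        and \<alpha>1: "\<alpha>\<^sub>1 = (\<lambda>(x, y). (a1 * \<phi> x + a2 * \<phi> y, b1 * \<phi> x + b2 * \<phi> y))"
        and \<alpha>2: "\<alpha>\<^sub>2 = (\<lambda>(x, y). (c1 * \<phi> x + c2 * \<phi> (cj y), cj (e1 * \<phi> x + e2 * \<phi> (cj y))))"
        and A: "a1 * b2 + a2 * b1 \<noteq> 0" and B: "c1 * e2 + c2 * e1 \<noteq> 0"
        and alt: "a2 = 0 \<and> b1 = 0 \<and> c2 = 0 \<and> e1 = 0 \<and> a1 * c1 = b2 * e2 \<and> (b2 * e2)\<^sup>2 = a1 * e2 * cj (a1 * e2) \<or>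
          a1 = 0 \<and> b2 = 0 \<and> c1 = 0 \<and> e2 = 0 \<and> a2 * c2 = b1 * e1 * (1 + w * cj w) \<and>
          (b1 * e1)\<^sup>2 * (1 + w * cj w) = a2 * e1 * cj (a2 * e1)"
      by blast
    note \<phi>s = field_automorphism_cj[OF \<phi>(1)]
    have N: "1 + w * cj w \<noteq> 0" using w by simp
    \<comment> \<open>Only the first two components are matched here, with \<open>p\<close>
      identified by uniqueness of square roots; \<open>isotopy_unique\<close> then settles the
      third.\<close>
    have "\<exists>\<epsilon> a e h. a \<noteq> 0 \<and> e \<noteq> 0 \<and> autotopism w (\<phi>, \<epsilon>, a, e) = (\<alpha>\<^sub>1, \<alpha>\<^sub>2, h)"
      using alt
    proof (elim disjE conjE)
      assume z: "a2 = 0" "b1 = 0" "c2 = 0" "e1 = 0" and ac: "a1 * c1 = b2 * e2"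
        and sq: "(b2 * e2)\<^sup>2 = a1 * e2 * cj (a1 * e2)"
      have nz: "a1 \<noteq> 0" "e2 \<noteq> 0" using A B z by auto
      have "sqrt2 (a1 * e2 * cj (a1 * e2)) = b2 * e2" using sq by (rule sqrt2_eqI)
      moreover have "b2 * e2 * x / a1 = c1 * x" for x unfolding ac[symmetric] using nz by simp
      ultimately have "autotopism w (\<phi>, False, a1, e2) =
          (\<alpha>\<^sub>1, \<alpha>\<^sub>2, snd (snd (autotopism w (\<phi>, False, a1, e2))))"
        using z nz by (simp add: Let_def \<alpha>1 \<alpha>2 \<phi>s cj_mult)
      then show ?thesis using nz by blast
    next
      assume z: "a1 = 0" "b2 = 0" "c1 = 0" "e2 = 0" and ac: "a2 * c2 = b1 * e1 * (1 + w * cj w)"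
        and sq: "(b1 * e1)\<^sup>2 * (1 + w * cj w) = a2 * e1 * cj (a2 * e1)"
      have nz: "a2 \<noteq> 0" "e1 \<noteq> 0" using A B z by auto
      have "sqrt2 (a2 * e1 * cj (a2 * e1) / (1 + w * cj w)) = b1 * e1"
        using N by (intro sqrt2_eqI) (simp add: sq[symmetric])
      moreover have "b1 * e1 * (1 + w * cj w) * x / a2 = c2 * x" for x
        unfolding ac[symmetric] using nz by simp
      ultimately have "autotopism w (\<phi>, True, a2, e1) =
          (\<alpha>\<^sub>1, \<alpha>\<^sub>2, snd (snd (autotopism w (\<phi>, True, a2, e1))))"
        using z nz by (simp add: Let_def \<alpha>1 \<alpha>2 \<phi>s cj_mult)
      then show ?thesis using nz by blast
    qed
    then obtain \<epsilon> a e h where ae: "a \<noteq> 0" "e \<noteq> 0"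
      and eq: "autotopism w (\<phi>, \<epsilon>, a, e) = (\<alpha>\<^sub>1, \<alpha>\<^sub>2, h)"
      by blast
    have "h = \<beta>"
      using isotopy_autotopism[OF w \<phi> ae, of \<epsilon>] iso unfolding eq by (rule isotopy_unique)
    then have "t = autotopism w (\<phi>, \<epsilon>, a, e)" by (simp add: tt eq)
    then show "t \<in> autotopism w ` ?P" using \<phi> ae by blast
  qed
qed

section \<open>Isotopism classes and the order of the autotopism group\<close>

lemma isotopy_of_automorphism:
  fixes w :: 'a
  assumes \<phi>: "field_automorphism \<phi>"
  shows "isotopic (B_mult q w) (B_mult q (\<phi> w))"
proof -
  define \<psi> where "\<psi> = inv_into UNIV \<phi>"
  have \<psi>: "field_automorphism \<psi>" unfolding \<psi>_def by (rule field_automorphism_inv[OF \<phi>])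
  note \<phi>s = field_automorphism_simps[OF \<phi>] field_automorphism_cj[OF \<phi>]
    and \<psi>s = field_automorphism_simps[OF \<psi>]
  have "bij (map_prod \<phi> \<phi>)" "bij (map_prod \<psi> \<psi>)"
    using \<phi> \<psi> by (simp_all add: field_automorphism_def bij_def map_prod_surj prod.inj_map)
  \<comment> \<open>Automorphisms commute with \<open>cj\<close>, so applying \<open>\<phi>\<close>
    to the coordinates changes only the parameter \<open>w\<close>.\<close>
  moreover have "map_prod \<phi> \<phi> (B_mult q w (map_prod \<psi> \<psi> x) (map_prod \<psi> \<psi> y)) = B_mult q (\<phi> w) x y" for x y
  proof -
    have "\<phi> (\<psi> z) = z" for z by (simp add: \<psi>_def \<phi>s)
    then show ?thesis by (cases x; cases y) (simp add: B_mult_cj \<phi>s)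
  qed
  moreover have "additive (map_prod \<phi> \<phi>)" "additive (map_prod \<psi> \<psi>)"
    by (auto intro!: additive.intro simp: \<phi>s \<psi>s)
  ultimately have "isotopy (B_mult q w) (B_mult q (\<phi> w)) (map_prod \<psi> \<psi>, map_prod \<psi> \<psi>, map_prod \<phi> \<phi>)"
    by (simp add: isotopy_def del: split_paired_All)
  then show ?thesis unfolding isotopic_def by blast
qed

end

theorem theorem6:
  fixes s q :: nat and K :: "'a::{field,finite} set" and w v :: 'a
  assumes "s \<ge> 1" and "q = 2 ^ s"
    and "CARD('a) = q ^ 2"
    and "is_subfield K" and "card K = q"
    and "w \<notin> K" and "abs_trace s (1 / rel_trace q w) = 0"
    and "v \<notin> K" and "abs_trace s (1 / rel_trace q v) = 0"
  shows "(isotopic (B_mult q w) (B_mult q v) \<longleftrightarrow> (\<exists>\<phi>. field_automorphism \<phi> \<and> v = \<phi> w)) \<and>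
    order (autotopism_group (B_mult q w)) =
      2 * card (stabilizer (galois_group {0, 1}) (\<lambda>\<phi>. \<phi>) w) * (q ^ 2 - 1) ^ 2"
proof -
  interpret quadratic_extension s q "TYPE('a)"
    by unfold_locales (use assms in auto)
  note K = subfield_iff_cj[OF assms(4,5)]
  have w: "cj w \<noteq> w" and v: "cj v \<noteq> v" using assms(6,8) K by auto
  have Nw: "w * cj w \<noteq> 1" and Nv: "v * cj v \<noteq> 1"
    using norm_neq_1 w v assms(7,9) by blast+
  have "isotopic (B_mult q w) (B_mult q v) \<longleftrightarrow> (\<exists>\<phi>. field_automorphism \<phi> \<and> v = \<phi> w)"
  proof
    assume "isotopic (B_mult q w) (B_mult q v)"
    then obtain \<alpha>\<^sub>1 \<alpha>\<^sub>2 \<beta> where "isotopy (B_mult q w) (B_mult q v) (\<alpha>\<^sub>1, \<alpha>\<^sub>2, \<beta>)"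
      unfolding isotopic_def by auto
    then obtain \<phi> where \<phi>: "field_automorphism \<phi>" "\<phi> v = w"
      using isotopy_form[OF w v Nv] by metis
    then have "v = inv_into UNIV \<phi> w" by (auto simp: field_automorphism_simps[OF \<phi>(1)])
    then show "\<exists>\<phi>. field_automorphism \<phi> \<and> v = \<phi> w"
      using field_automorphism_inv[OF \<phi>(1)] by blast
  next
    assume "\<exists>\<phi>. field_automorphism \<phi> \<and> v = \<phi> w"
    then show "isotopic (B_mult q w) (B_mult q v)" using isotopy_of_automorphism by blast
  qed
  moreover have "order (autotopism_group (B_mult q w)) =
      2 * card (stabilizer (galois_group {0, 1}) (\<lambda>\<phi>. \<phi>) w) * (q ^ 2 - 1) ^ 2"
  proof -
    \<comment> \<open>Every automorphism fixes 0 and 1, so this stabilizer is the set of companions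
      counted in \<open>autotopisms_bij\<close>.\<close>
    have "stabilizer (galois_group {0, 1}) (\<lambda>\<phi>. \<phi>) w = {\<phi>. field_automorphism \<phi> \<and> \<phi> w = w}"
      by (auto simp: stabilizer_def galois_group_def field_automorphism_simps)
    then show ?thesis
      using bij_betw_same_card[OF autotopisms_bij[OF w Nw], symmetric] assms(3)
      by (simp add: order_def autotopism_group_def card_cartesian_product card_Diff_singleton power2_eq_square)
  qed
  ultimately show ?thesis ..
qed

end
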